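(* Let $G$ be a snark with a non-removable pair of adjacent vertices $\{u,v\}$, and let $\bar G$ be the snark arising from $G$ by inflating both $u$ and $v$ to a triangle. Then $3\le \operatorname{df}(\bar G)\le 4$.
   Context: Graphs are finite and undirected; parallel edges and loops are permitted. A snark is a $2$-connected cubic graph that does not admit a $3$-edge-colouring (an assignment of three colours to edges with adjacent edges receiving distinct colours). A pair $\{u,v\}$ of vertices of a snark $G$ is non-removable if the graph $G-\{u,v\}$ obtained by deleting $u$ and $v$ is $3$-edge-colourable. Inflating a vertex $w$ with incident edges $e_1,e_2,e_3$ to a triangle means replacing $w$ by three new mutually adjacent vertices $w_1,w_2,w_3$ and making $e_i$ incident with $w_i$ instead of $w$ ($i=1,2,3$). A $3$-array of a cubic graph is a collection of three (not necessarily distinct) perfect matchings; an edge is uncovered if it belongs to none of them. The defect $\operatorname{df}(H)$ of a bridgeless cubic graph $H$ is the minimum number of uncovered edges over all $3$-arrays of $H$. *)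

theory Defs
  imports Main "HOL-Library.Multiset"
begin

text \<open>
  Undirected multigraphs: every edge carries the multiset of its two ends, so that edges with
  equal \<open>ends\<close> are parallel and an edge with ends \<open>{#x, x#}\<close> is a loop.
\<close>

record ('v, 'e) mgraph =
  verts :: "'v set"
  edges :: "'e set"
  ends :: "'e \<Rightarrow> 'v multiset"

definition finite_mgraph :: "('v, 'e) mgraph \<Rightarrow> bool" where
  "finite_mgraph G \<longleftrightarrow> finite (verts G) \<and> finite (edges G) \<and>
     (\<forall>e\<in>edges G. size (ends G e) = 2 \<and> set_mset (ends G e) \<subseteq> verts G)"

definition adjacent :: "('v, 'e) mgraph \<Rightarrow> 'v \<Rightarrow> 'v \<Rightarrow> bool" where
  "adjacent G x y \<longleftrightarrow> (\<exists>e\<in>edges G. ends G e = {#x, y#})"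

definition inc_edges :: "('v, 'e) mgraph \<Rightarrow> 'v \<Rightarrow> 'e set" where
  "inc_edges G v = {e \<in> edges G. v \<in># ends G e}"

definition is_loop :: "('v, 'e) mgraph \<Rightarrow> 'e \<Rightarrow> bool" where
  "is_loop G e \<longleftrightarrow> (\<exists>x. ends G e = {#x, x#})"

definition degree :: "('v, 'e) mgraph \<Rightarrow> 'v \<Rightarrow> nat" where
  "degree G v = (\<Sum>e\<in>edges G. count (ends G e) v)"

definition cubic :: "('v, 'e) mgraph \<Rightarrow> bool" where
  "cubic G \<longleftrightarrow> finite_mgraph G \<and> (\<forall>v\<in>verts G. degree G v = 3)"

definition delete_verts :: "('v, 'e) mgraph \<Rightarrow> 'v set \<Rightarrow> ('v, 'e) mgraph" where
  "delete_verts G S =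
     \<lparr>verts = verts G - S, edges = {e \<in> edges G. set_mset (ends G e) \<inter> S = {}}, ends = ends G\<rparr>"

definition connected_mgraph :: "('v, 'e) mgraph \<Rightarrow> bool" where
  "connected_mgraph G \<longleftrightarrow> verts G \<noteq> {} \<and>
     (\<forall>x\<in>verts G. \<forall>y\<in>verts G. (adjacent G)\<^sup>*\<^sup>* x y)"

text \<open>
  The bound on the number of vertices rules out the graph consisting of two loops joined by a
  bridge. It also rules out the graph with two vertices and three parallel edges, which is
  3-edge-colourable and hence irrelevant for snarks.
\<close>

definition two_connected :: "('v, 'e) mgraph \<Rightarrow> bool" where
  "two_connected G \<longleftrightarrow> card (verts G) \<ge> 3 \<and> connected_mgraph G \<and>
     (\<forall>x\<in>verts G. connected_mgraph (delete_verts G {x}))"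

text \<open>A loop is adjacent to itself, so a graph with a loop has no proper edge-colouring.\<close>

definition three_edge_colouring :: "('v, 'e) mgraph \<Rightarrow> ('e \<Rightarrow> nat) \<Rightarrow> bool" where
  "three_edge_colouring G c \<longleftrightarrow> (\<forall>e\<in>edges G. c e < 3 \<and> \<not> is_loop G e) \<and>
     (\<forall>e\<in>edges G. \<forall>f\<in>edges G. e \<noteq> f \<longrightarrow> set_mset (ends G e) \<inter> set_mset (ends G f) \<noteq> {} \<longrightarrow>
        c e \<noteq> c f)"

definition three_edge_colourable :: "('v, 'e) mgraph \<Rightarrow> bool" where
  "three_edge_colourable G \<longleftrightarrow> (\<exists>c. three_edge_colouring G c)"

definition snark :: "('v, 'e) mgraph \<Rightarrow> bool" where
  "snark G \<longleftrightarrow> cubic G \<and> two_connected G \<and> \<not> three_edge_colourable G"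

definition non_removable :: "('v, 'e) mgraph \<Rightarrow> 'v \<Rightarrow> 'v \<Rightarrow> bool" where
  "non_removable G u v \<longleftrightarrow> u \<in> verts G \<and> v \<in> verts G \<and> u \<noteq> v \<and>
     three_edge_colourable (delete_verts G {u, v})"

text \<open>
  \<open>inflates G w H\<close>: the graph \<open>H\<close> arises from \<open>G\<close> by inflating \<open>w\<close> to a triangle. The names of
  the new vertices and edges are arbitrary, so \<open>H\<close> is determined up to isomorphism. In a cubic
  graph the three edges \<open>e1\<close>, \<open>e2\<close>, \<open>e3\<close> are distinct iff there is no loop at \<open>w\<close>; snarks have
  no loops.
\<close>

definition inflates :: "('v, 'e) mgraph \<Rightarrow> 'v \<Rightarrow> ('v, 'e) mgraph \<Rightarrow> bool" where
  "inflates G w H \<longleftrightarrow> w \<in> verts G \<and>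
     (\<exists>e1 e2 e3 w1 w2 w3 f1 f2 f3.
        distinct [e1, e2, e3] \<and> inc_edges G w = {e1, e2, e3} \<and>
        distinct [w1, w2, w3] \<and> {w1, w2, w3} \<inter> verts G = {} \<and>
        distinct [f1, f2, f3] \<and> {f1, f2, f3} \<inter> edges G = {} \<and>
        verts H = (verts G - {w}) \<union> {w1, w2, w3} \<and>
        edges H = edges G \<union> {f1, f2, f3} \<and>
        ends H f1 = {#w2, w3#} \<and> ends H f2 = {#w1, w3#} \<and> ends H f3 = {#w1, w2#} \<and>
        ends H e1 = add_mset w1 (ends G e1 - {#w#}) \<and>
        ends H e2 = add_mset w2 (ends G e2 - {#w#}) \<and>
        ends H e3 = add_mset w3 (ends G e3 - {#w#}) \<and>
        (\<forall>e\<in>edges G - {e1, e2, e3}. ends H e = ends G e))"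

definition perfect_matching :: "('v, 'e) mgraph \<Rightarrow> 'e set \<Rightarrow> bool" where
  "perfect_matching G M \<longleftrightarrow> M \<subseteq> edges G \<and> (\<forall>e\<in>M. \<not> is_loop G e) \<and>
     (\<forall>v\<in>verts G. \<exists>!e. e \<in> M \<and> v \<in># ends G e)"

definition three_array :: "('v, 'e) mgraph \<Rightarrow> 'e set \<Rightarrow> 'e set \<Rightarrow> 'e set \<Rightarrow> bool" where
  "three_array G M1 M2 M3 \<longleftrightarrow>
     perfect_matching G M1 \<and> perfect_matching G M2 \<and> perfect_matching G M3"

definition uncovered :: "('v, 'e) mgraph \<Rightarrow> 'e set \<Rightarrow> 'e set \<Rightarrow> 'e set \<Rightarrow> 'e set" where
  "uncovered G M1 M2 M3 = edges G - (M1 \<union> M2 \<union> M3)"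

definition defect :: "('v, 'e) mgraph \<Rightarrow> nat" where
  "defect G = (LEAST k. \<exists>M1 M2 M3. three_array G M1 M2 M3 \<and> card (uncovered G M1 M2 M3) = k)"

text \<open>
  The hypothesis \<open>inflates G w H\<close> can only be satisfied if the types supply fresh names; over
  infinite types it always can.
\<close>

lemma fresh_three:
  assumes "finite A" "infinite (UNIV :: 'a set)"
  shows "\<exists>a b c :: 'a. distinct [a, b, c] \<and> {a, b, c} \<inter> A = {}"
proof -
  obtain a where a: "a \<notin> A" using assms ex_new_if_finite by blast
  obtain b where b: "b \<notin> insert a A" using assms ex_new_if_finite by (metis finite_insert)
  obtain c where c: "c \<notin> insert b (insert a A)"
    using assms ex_new_if_finite by (metis finite_insert)
  show ?thesis using a b c by (intro exI[of _ a] exI[of _ b] exI[of _ c]) auto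
qed

lemma inflates_exists:
  fixes G :: "('v, 'e) mgraph"
  assumes G: "cubic G" and w: "w \<in> verts G" and nl: "\<forall>e\<in>inc_edges G w. \<not> is_loop G e"
    and inf: "infinite (UNIV :: 'v set)" "infinite (UNIV :: 'e set)"
  shows "\<exists>H. inflates G w H"
proof -
  have fin: "finite (verts G)" "finite (edges G)"
    and sz: "\<And>e. e \<in> edges G \<Longrightarrow> size (ends G e) = 2"
    using G by (auto simp: cubic_def finite_mgraph_def)
  have one: "count (ends G e) w = 1" if e: "e \<in> inc_edges G w" for e
  proof -
    have eE: "e \<in> edges G" and we: "w \<in># ends G e" using e by (auto simp: inc_edges_def)
    obtain N where N: "ends G e = add_mset w N" using we by (metis mset_add)
    with sz[OF eE] have "size N = 1" by simp
    then obtain y where "N = {#y#}" by (metis size_1_singleton_mset)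
    with N nl e show ?thesis by (auto simp: is_loop_def)
  qed
  have "degree G w = (\<Sum>e\<in>inc_edges G w. count (ends G e) w)"
    unfolding degree_def
    by (rule sum.mono_neutral_right) (auto simp: inc_edges_def fin not_in_iff)
  also have "\<dots> = card (inc_edges G w)" using one by simp
  finally have "card (inc_edges G w) = 3" using G w by (simp add: cubic_def)
  then obtain e1 e2 e3 where e: "inc_edges G w = {e1, e2, e3}" "distinct [e1, e2, e3]"
    by (auto simp: card_3_iff)
  obtain w1 w2 w3 where ws: "distinct [w1, w2, w3]" "{w1, w2, w3} \<inter> verts G = {}"
    using fresh_three[OF fin(1) inf(1)] by blast
  obtain f1 f2 f3 where fs: "distinct [f1, f2, f3]" "{f1, f2, f3} \<inter> edges G = {}"
    using fresh_three[OF fin(2) inf(2)] by blast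
  have eE: "e1 \<in> edges G" "e2 \<in> edges G" "e3 \<in> edges G" using e by (auto simp: inc_edges_def)
  define H :: "('v, 'e) mgraph" where "H =
     \<lparr>verts = (verts G - {w}) \<union> {w1, w2, w3}, edges = edges G \<union> {f1, f2, f3},
      ends = (ends G)(f1 := {#w2, w3#}, f2 := {#w1, w3#}, f3 := {#w1, w2#},
        e1 := add_mset w1 (ends G e1 - {#w#}), e2 := add_mset w2 (ends G e2 - {#w#}),
        e3 := add_mset w3 (ends G e3 - {#w#}))\<rparr>"
  have "inflates G w H"
    unfolding inflates_def
  proof (intro conjI exI)
    show "w \<in> verts G" by fact
    show "inc_edges G w = {e1, e2, e3}" "distinct [e1, e2, e3]" by fact+
    show "distinct [w1, w2, w3]" "{w1, w2, w3} \<inter> verts G = {}" by fact+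
    show "distinct [f1, f2, f3]" "{f1, f2, f3} \<inter> edges G = {}" by fact+
    show "verts H = (verts G - {w}) \<union> {w1, w2, w3}" "edges H = edges G \<union> {f1, f2, f3}"
      by (simp_all add: H_def)
    show "ends H f1 = {#w2, w3#}" "ends H f2 = {#w1, w3#}" "ends H f3 = {#w1, w2#}"
      unfolding H_def using fs eE by auto
    show "ends H e1 = add_mset w1 (ends G e1 - {#w#})"
      "ends H e2 = add_mset w2 (ends G e2 - {#w#})"
      "ends H e3 = add_mset w3 (ends G e3 - {#w#})"
      unfolding H_def using e(2) by auto
    show "\<forall>x\<in>edges G - {e1, e2, e3}. ends H x = ends G x"
      unfolding H_def using fs(2) by auto
  qed
  then show ?thesis by blast
qed

end

theory Submission
  imports Defs
begin

text \<open>
  Lower bound: a cubic graph with two disjoint perfect matchings is 3-edge-colourable, so in a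
  3-array of a non-colourable graph any two members meet. Since three perfect matchings have
  \<open>|E|\<close> edges in total, at least two edges are uncovered; if exactly two are, then all three
  members share an edge \<open>g\<close>, the uncovered edges are parallel to \<open>g\<close>, and exchanging \<open>g\<close> for
  one of them in one member makes it disjoint from another.

  Upper bound: extend a colouring of \<open>G - {u, v}\<close> to all edges of \<open>G\<close>. By parity, either \<open>G\<close>
  is colourable or the two edges other than \<open>uv\<close> at \<open>u\<close> have equal colours, and likewise at \<open>v\<close>.
  Each colour class together with \<open>uv\<close>, completed where necessary by the edge of the triangle
  that is opposite to \<open>uv\<close>, is a perfect matching of the inflated graph. The three of them miss
  only the two remaining edges of each triangle.
\<close>

section \<open>Loopless cubic graphs and double counting\<close>

text \<open>Without loops the degree is the number of incident edges, so cubicity can be stated by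
  counting sets. This property and non-colourability are what inflation is shown to carry from
  \<open>G\<close> to \<open>Gbar\<close>.\<close>

definition loopless_cubic :: "('v, 'e) mgraph \<Rightarrow> bool" where
  "loopless_cubic G \<longleftrightarrow> finite_mgraph G \<and> (\<forall>e\<in>edges G. \<not> is_loop G e) \<and>
     (\<forall>x\<in>verts G. card (inc_edges G x) = 3)"

lemma loopless_cubicD:
  assumes "loopless_cubic G"
  shows "finite (verts G)" "finite (edges G)" "\<And>x. finite (inc_edges G x)"
    "\<And>x. x \<in> verts G \<Longrightarrow> card (inc_edges G x) = 3"
  using assms by (auto simp: loopless_cubic_def finite_mgraph_def inc_edges_def)

lemma other_end:
  assumes "finite_mgraph G" "e \<in> edges G" "\<not> is_loop G e" "x \<in># ends G e"
  obtains y where "y \<noteq> x" "x \<in> verts G" "y \<in> verts G" "ends G e = {#x, y#}"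
proof -
  obtain N where N: "ends G e = add_mset x N" using assms(4) by (metis mset_add)
  moreover have "size (ends G e) = 2" "set_mset (ends G e) \<subseteq> verts G"
    using assms(1,2) by (auto simp: finite_mgraph_def)
  ultimately obtain y where "N = {#y#}" by (metis One_nat_def Suc_1 add_diff_cancel_left' plus_1_eq_Suc
        size_1_singleton_mset size_add_mset)
  with N assms that[of y] \<open>set_mset (ends G e) \<subseteq> verts G\<close> show thesis
    by (auto simp: is_loop_def)
qed

lemma loopless_cubic_other_end:
  assumes "loopless_cubic G" "e \<in> edges G" "x \<in># ends G e"
  obtains y where "y \<noteq> x" "x \<in> verts G" "y \<in> verts G" "ends G e = {#x, y#}"
  using assms other_end[of G e x] by (auto simp: loopless_cubic_def)

lemma loopless_cubic_two_ends:
  assumes "loopless_cubic G" "e \<in> edges G"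
  shows "card {x \<in> verts G. x \<in># ends G e} = 2"
proof -
  have "size (ends G e) = 2" using assms by (auto simp: loopless_cubic_def finite_mgraph_def)
  then obtain x where "x \<in># ends G e" by fastforce
  then obtain y where y: "y \<noteq> x" "x \<in> verts G" "y \<in> verts G" "ends G e = {#x, y#}"
    using loopless_cubic_other_end[OF assms] by blast
  then have "{x \<in> verts G. x \<in># ends G e} = {x, y}" by auto
  with y show ?thesis by simp
qed

text \<open>Double counting of incidences, each edge having two distinct ends. It is applied to all
  edges, to a perfect matching and to a colour class.\<close>

lemma handshake:
  assumes "loopless_cubic G" "M \<subseteq> edges G"
  shows "(\<Sum>x\<in>verts G. card {e \<in> M. x \<in># ends G e}) = 2 * card M"
proof (rule sum_multicount)
  show "finite (verts G)" "finite M"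
    using loopless_cubicD(1,2)[OF assms(1)] assms(2) by (auto intro: finite_subset)
  show "\<forall>e\<in>M. card {x \<in> verts G. x \<in># ends G e} = 2"
    using loopless_cubic_two_ends[OF assms(1)] assms(2) by auto
qed

lemma card_edges_loopless_cubic:
  assumes "loopless_cubic G"
  shows "3 * card (verts G) = 2 * card (edges G)"
  using handshake[OF assms order_refl] loopless_cubicD(4)[OF assms]
  by (simp add: inc_edges_def)

section \<open>Snarks have no loops; colourings vertex by vertex\<close>

text \<open>A loop at \<open>x\<close> uses two of its three degrees, so a single further edge
  \<open>h\<close> leaves \<open>x\<close>, to a vertex \<open>y\<close>. Deleting \<open>y\<close>
  then separates \<open>x\<close> from a third vertex \<open>z\<close>, against
  2-connectedness.\<close>

lemma snark_loopless:
  assumes "snark G" "e \<in> edges G"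
  shows "\<not> is_loop G e"
proof
  assume "is_loop G e"
  then obtain x where x: "ends G e = {#x, x#}" by (auto simp: is_loop_def)
  have fin: "finite_mgraph G" and deg: "\<And>x. x \<in> verts G \<Longrightarrow> degree G x = 3"
    and tc: "two_connected G"
    using assms(1) by (auto simp: snark_def cubic_def)
  have finE: "finite (edges G)" and xV: "x \<in> verts G"
    using fin assms(2) x by (auto simp: finite_mgraph_def)
  have "(\<Sum>h\<in>edges G - {e}. count (ends G h) x) = 1"
    using deg[OF xV] sum.remove[OF finE assms(2), of "\<lambda>h. count (ends G h) x"] x
    by (simp add: degree_def)
  then obtain h where h: "h \<in> edges G" "h \<noteq> e" "count (ends G h) x = 1"
    and others: "\<And>b. b \<in> edges G - {e} \<Longrightarrow> h \<noteq> b \<Longrightarrow> count (ends G b) x = 0"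
    using finE by (auto simp: sum_eq_Suc0_iff)
  have "\<not> is_loop G h" using h(3) by (auto simp: is_loop_def split: if_splits)
  moreover have "x \<in># ends G h" using h(3) by (metis count_eq_zero_iff zero_neq_one)
  ultimately obtain y where y: "y \<noteq> x" "y \<in> verts G" "ends G h = {#x, y#}"
    using other_end[OF fin h(1)] by blast
  have "\<not> verts G \<subseteq> {x, y}"
  proof
    assume "verts G \<subseteq> {x, y}"
    then have "card (verts G) \<le> card {x, y}" by (intro card_mono) auto
    also have "\<dots> \<le> 2" by (simp add: card_insert_if)
    finally show False using tc by (auto simp: two_connected_def)
  qed
  then obtain z where z: "z \<in> verts G" "z \<noteq> x" "z \<noteq> y" by auto
  let ?D = "delete_verts G {y}"
  have "(adjacent ?D)\<^sup>*\<^sup>* x z"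
    using tc xV y z by (auto simp: two_connected_def connected_mgraph_def delete_verts_def)
  \<comment> \<open>Away from \<open>y\<close> the only edge at \<open>x\<close> is the loop, so a
    walk from \<open>x\<close> never leaves it.\<close>
  moreover have "t = x" if "(adjacent ?D)\<^sup>*\<^sup>* x t" for t
    using that
  proof (induction rule: rtranclp_induct)
    case (step s t)
    then obtain b where b: "b \<in> edges G" "y \<notin># ends G b" "ends G b = {#x, t#}"
      by (auto simp: adjacent_def delete_verts_def)
    then have "b \<noteq> h" using y by auto
    moreover have "count (ends G b) x \<noteq> 0" using b(3) by simp
    ultimately have "b = e" using others[of b] b(1) by (metis Diff_iff singletonD)
    with x b(3) show ?case by (auto simp: add_eq_conv_ex)
  qed simp
  ultimately show False using z(2) by blast
qed

lemma snark_loopless_cubic: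
  assumes "snark G"
  shows "loopless_cubic G"
  unfolding loopless_cubic_def
proof (intro conjI ballI)
  show fin: "finite_mgraph G" using assms by (simp add: snark_def cubic_def)
  show nl: "\<not> is_loop G e" if "e \<in> edges G" for e using snark_loopless[OF assms that] .
  fix x assume x: "x \<in> verts G"
  have "count (ends G e) x = 1" if "e \<in> inc_edges G x" for e
  proof -
    have "e \<in> edges G" "x \<in># ends G e" using that by (auto simp: inc_edges_def)
    then show ?thesis using other_end[OF fin _ nl] by (metis count_add_mset count_empty count_single One_nat_def)
  qed
  moreover have "degree G x = (\<Sum>e\<in>inc_edges G x. count (ends G e) x)"
    unfolding degree_def using fin
    by (intro sum.mono_neutral_right) (auto simp: inc_edges_def finite_mgraph_def not_in_iff)
  ultimately show "card (inc_edges G x) = 3"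
    using assms x by (simp add: snark_def cubic_def)
qed

text \<open>Edges with a common end meet in a vertex of \<open>G\<close>, so properness can be
  tested at one vertex at a time; the ban on loops holds by assumption.\<close>

lemma three_edge_colourable_iff:
  assumes "loopless_cubic G"
  shows "three_edge_colourable G \<longleftrightarrow>
    (\<exists>c. (\<forall>e\<in>edges G. c e < (3::nat)) \<and> (\<forall>x\<in>verts G. inj_on c (inc_edges G x)))"
proof -
  have sub: "set_mset (ends G e) \<subseteq> verts G" "\<not> is_loop G e" if "e \<in> edges G" for e
    using assms that by (auto simp: loopless_cubic_def finite_mgraph_def)
  have "three_edge_colouring G c \<longleftrightarrow>
    (\<forall>e\<in>edges G. c e < 3) \<and> (\<forall>x\<in>verts G. inj_on c (inc_edges G x))" for c
    unfolding three_edge_colouring_def inj_on_def inc_edges_def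
    using sub by (auto; blast)
  then show ?thesis by (simp add: three_edge_colourable_def)
qed

section \<open>Perfect matchings and the lower bound\<close>

lemma perfect_matching_subset: "perfect_matching G M \<Longrightarrow> M \<subseteq> edges G"
  by (simp add: perfect_matching_def)

lemma perfect_matching_inc:
  assumes "perfect_matching G M" "x \<in> verts G"
  obtains a where "M \<inter> inc_edges G x = {a}"
proof -
  have "\<exists>!e. e \<in> M \<and> x \<in># ends G e" using assms by (simp add: perfect_matching_def)
  then obtain a where a: "{e. e \<in> M \<and> x \<in># ends G e} = {a}"
    by (elim ex1E) blast
  have "M \<inter> inc_edges G x = {e. e \<in> M \<and> x \<in># ends G e}"
    using perfect_matching_subset[OF assms(1)] by (auto simp: inc_edges_def)
  with a show thesis by (intro that) simp
qed

lemma card_perfect_matching: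
  assumes "loopless_cubic G" "perfect_matching G M"
  shows "2 * card M = card (verts G)"
proof -
  have M: "M \<subseteq> edges G" using assms(2) by (simp add: perfect_matching_def)
  have "card {e \<in> M. x \<in># ends G e} = 1" if x: "x \<in> verts G" for x
  proof -
    obtain a where "M \<inter> inc_edges G x = {a}" using perfect_matching_inc[OF assms(2) x] .
    moreover have "{e \<in> M. x \<in># ends G e} = M \<inter> inc_edges G x"
      using M by (auto simp: inc_edges_def)
    ultimately show ?thesis by simp
  qed
  then show ?thesis using handshake[OF assms(1) M] by simp
qed

text \<open>Each vertex meets one edge of \<open>M\<close> and another one of \<open>N\<close>,
  hence exactly one edge outside both; so the remaining edges form a third colour class.\<close>

lemma disjoint_matchings_colourable:
  assumes G: "loopless_cubic G" and M: "perfect_matching G M" and N: "perfect_matching G N"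
    and disj: "M \<inter> N = {}"
  shows "three_edge_colourable G"
proof -
  define c where "c e = (if e \<in> M then 0 else if e \<in> N then 1 else 2 :: nat)" for e
  have "inj_on c (inc_edges G x)" if x: "x \<in> verts G" for x
  proof -
    obtain a where a: "M \<inter> inc_edges G x = {a}" using perfect_matching_inc[OF M x] .
    obtain b where b: "N \<inter> inc_edges G x = {b}" using perfect_matching_inc[OF N x] .
    have ab: "a \<noteq> b" "{a, b} \<subseteq> inc_edges G x" using a b disj by auto
    then have "card (inc_edges G x - {a, b}) = 1"
      using loopless_cubicD[OF G] x by (simp add: card_Diff_subset)
    then obtain d where "inc_edges G x - {a, b} = {d}" by (auto simp: card_1_singleton_iff)
    then have inc: "inc_edges G x = {a, b, d}" "d \<noteq> a" "d \<noteq> b" using ab by auto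
    have "a \<in> M" "b \<in> N" using a b by auto
    moreover have "b \<notin> M" using \<open>b \<in> N\<close> disj by auto
    moreover have "d \<notin> M" "d \<notin> N" using a b inc by auto
    ultimately have "c a = 0" "c b = 1" "c d = 2" by (auto simp: c_def)
    then show ?thesis unfolding inc by auto
  qed
  moreover have "\<forall>e\<in>edges G. c e < 3" by (simp add: c_def)
  ultimately show ?thesis using three_edge_colourable_iff[OF G] by blast
qed

text \<open>A perfect matching has |V|/2 edges and |E| = 3|V|/2, so the sizes of the three members
  add up to |E|. Inclusion-exclusion then balances uncovered edges against overlaps.\<close>

lemma card_uncovered:
  assumes G: "loopless_cubic G" and arr: "three_array G M1 M2 M3"
  shows "card (uncovered G M1 M2 M3) + card (M1 \<inter> M2 \<inter> M3) =
    card (M1 \<inter> M2) + card (M1 \<inter> M3) + card (M2 \<inter> M3)"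
proof -
  have pm: "perfect_matching G M1" "perfect_matching G M2" "perfect_matching G M3"
    using arr by (auto simp: three_array_def)
  then have sub: "M1 \<subseteq> edges G" "M2 \<subseteq> edges G" "M3 \<subseteq> edges G"
    by (simp_all add: perfect_matching_subset)
  then have fin: "finite M1" "finite M2" "finite M3"
    using loopless_cubicD(2)[OF G] by (auto intro: finite_subset)
  have "card (edges G) = card M1 + card M2 + card M3"
    using pm[THEN card_perfect_matching[OF G]] card_edges_loopless_cubic[OF G] by linarith
  moreover have "card (uncovered G M1 M2 M3) + card (M1 \<union> M2 \<union> M3) = card (edges G)"
    unfolding uncovered_def using sub fin loopless_cubicD(2)[OF G]
    by (metis Un_least add.commute card_Diff_subset card_mono finite_UnI le_add_diff_inverse)
  moreover have "card M1 + card M2 = card (M1 \<union> M2) + card (M1 \<inter> M2)"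
    using fin by (intro card_Un_Int) auto
  moreover have "card (M1 \<union> M2) + card M3 = card (M1 \<union> M2 \<union> M3) + card ((M1 \<union> M2) \<inter> M3)"
    using fin by (intro card_Un_Int) auto
  moreover have "card (M1 \<inter> M3) + card (M2 \<inter> M3) =
      card ((M1 \<union> M2) \<inter> M3) + card (M1 \<inter> M2 \<inter> M3)"
    using fin card_Un_Int[of "M1 \<inter> M3" "M2 \<inter> M3"]
    by (simp add: Int_Un_distrib Int_ac)
  ultimately show ?thesis by linarith
qed

lemma perfect_matching_swap_parallel:
  assumes M: "perfect_matching G M" and g: "g \<in> M"
    and a: "a \<in> edges G - M" "ends G a = ends G g"
  shows "perfect_matching G (insert a (M - {g}))"
  unfolding perfect_matching_def
proof (intro conjI ballI)
  show "insert a (M - {g}) \<subseteq> edges G" using perfect_matching_subset[OF M] a by blast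
  have "\<not> is_loop G a" using M g a unfolding perfect_matching_def is_loop_def by metis
  then show "\<not> is_loop G e" if "e \<in> insert a (M - {g})" for e
    using that M unfolding perfect_matching_def by blast
  fix x assume "x \<in> verts G"
  then obtain e where e: "e \<in> M" "x \<in># ends G e" "\<And>b. b \<in> M \<Longrightarrow> x \<in># ends G b \<Longrightarrow> b = e"
    using M unfolding perfect_matching_def by metis
  show "\<exists>!e. e \<in> insert a (M - {g}) \<and> x \<in># ends G e"
  proof (cases "e = g")
    case True
    then show ?thesis using e a by (metis DiffE insertI1 insertE singletonI)
  next
    case False
    then have "x \<notin># ends G g" using e(3) g by metis
    then show ?thesis using e a False by (metis DiffI DiffD1 insertI2 insertE singletonD)
  qed
qed

lemma uncovered_ge_3:
  assumes G: "loopless_cubic G" and nc: "\<not> three_edge_colourable G"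
    and arr: "three_array G M1 M2 M3"
  shows "3 \<le> card (uncovered G M1 M2 M3)"
proof (rule ccontr)
  assume "\<not> ?thesis"
  then have small: "card (uncovered G M1 M2 M3) \<le> 2" by simp
  have pm: "perfect_matching G M1" "perfect_matching G M2" "perfect_matching G M3"
    using arr by (auto simp: three_array_def)
  then have sub: "M1 \<subseteq> edges G" "M2 \<subseteq> edges G" "M3 \<subseteq> edges G"
    by (simp_all add: perfect_matching_subset)
  then have fin: "finite M1" "finite M2" "finite M3"
    using loopless_cubicD(2)[OF G] by (auto intro: finite_subset)
  have "M1 \<inter> M2 \<noteq> {}" "M1 \<inter> M3 \<noteq> {}" "M2 \<inter> M3 \<noteq> {}"
    using pm disjoint_matchings_colourable[OF G] nc by blast+
  then have pos: "card (M1 \<inter> M2) > 0" "card (M1 \<inter> M3) > 0" "card (M2 \<inter> M3) > 0"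
    using fin by (auto simp: card_gt_0_iff)
  have le: "card (M1 \<inter> M2 \<inter> M3) \<le> card (M2 \<inter> M3)"
    using fin by (intro card_mono) auto
  note cnt = card_uncovered[OF G arr]
  \<comment> \<open>By \<open>le\<close>, the identity gives |M1 \<inter> M2| + |M1 \<inter> M3|
    \<le> 2, so both summands are 1. The triple intersection is then at least as large as
    \<open>M2 \<inter> M3\<close>, which is nonempty.\<close>
  have one: "card (M1 \<inter> M2) = 1" and triple: "card (M1 \<inter> M2 \<inter> M3) > 0"
    using small pos le cnt by linarith+
  then obtain g where g: "M1 \<inter> M2 = {g}" "g \<in> M3"
    by (metis Int_iff card_1_singletonE card_gt_0_iff ex_in_conv singletonD)
  have gM: "g \<in> M1" "g \<in> M2" "g \<in> M3" "g \<in> edges G" using g sub by auto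
  let ?U = "uncovered G M1 M2 M3"
  have finU: "finite ?U" using loopless_cubicD(2)[OF G] by (simp add: uncovered_def)
  \<comment> \<open>At an end of \<open>g\<close> all three members use \<open>g\<close>, so the
    other two edges there are uncovered; as at most two edges are uncovered, there are no
    others.\<close>
  have U: "inc_edges G x - {g} = ?U" if x: "x \<in> verts G" "x \<in># ends G g" for x
  proof (rule card_seteq[OF finU])
    have "g \<in> inc_edges G x" using x gM by (simp add: inc_edges_def)
    then show "card ?U \<le> card (inc_edges G x - {g})"
      using small loopless_cubicD[OF G] x by simp
    have "M \<inter> inc_edges G x = {g}" if M: "perfect_matching G M" "g \<in> M" for M
    proof -
      obtain b where "M \<inter> inc_edges G x = {b}" using perfect_matching_inc[OF M(1) x(1)] .
      then show ?thesis using M(2) \<open>g \<in> inc_edges G x\<close> by auto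
    qed
    from this[OF pm(1) gM(1)] this[OF pm(2) gM(2)] this[OF pm(3) gM(3)]
    show "inc_edges G x - {g} \<subseteq> ?U" by (auto simp: uncovered_def inc_edges_def)
  qed
  have "size (ends G g) = 2" using G gM by (auto simp: loopless_cubic_def finite_mgraph_def)
  then obtain x where "x \<in># ends G g" by fastforce
  then obtain y where y: "y \<noteq> x" "x \<in> verts G" "y \<in> verts G" "ends G g = {#x, y#}"
    using loopless_cubic_other_end[OF G gM(4)] by blast
  have "card (inc_edges G x - {g}) = 2"
    using loopless_cubicD[OF G] y gM by (simp add: inc_edges_def)
  then obtain a where a: "a \<in> inc_edges G x - {g}"
    by (metis card.empty ex_in_conv zero_neq_numeral)
  \<comment> \<open>Both ends of \<open>g\<close> yield the same set of uncovered edges, so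
    \<open>a\<close> is incident with \<open>x\<close> and \<open>y\<close>, that is, parallel to
    \<open>g\<close>.\<close>
  then have aU: "a \<in> ?U" using U y by auto
  then have "a \<in> inc_edges G y" using U[of y] y by auto
  with a have "a \<in> edges G" "x \<in># ends G a" "y \<in># ends G a" by (auto simp: inc_edges_def)
  moreover obtain z where "ends G a = {#x, z#}"
    using loopless_cubic_other_end[OF G calculation(1,2)] by blast
  ultimately have "ends G a = ends G g" using y by auto
  moreover have "a \<in> edges G - M1" using aU by (simp add: uncovered_def)
  ultimately have "perfect_matching G (insert a (M1 - {g}))"
    using perfect_matching_swap_parallel[OF pm(1) gM(1)] by blast
  \<comment> \<open>\<open>g\<close> was the only common edge of \<open>M1\<close> and
    \<open>M2\<close>, and the uncovered \<open>a\<close> lies in neither.\<close>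
  moreover have "insert a (M1 - {g}) \<inter> M2 = {}"
    using g aU by (auto simp: uncovered_def)
  ultimately show False using disjoint_matchings_colourable[OF G _ pm(2)] nc by blast
qed

section \<open>Inflating a vertex to a triangle\<close>

lemma third_colour:
  fixes a p q r :: nat
  assumes "a \<noteq> q" "a \<noteq> r" "p \<noteq> q" "p \<noteq> r" "q \<noteq> r" "a < 3" "p < 3" "q < 3" "r < 3"
  shows "a = p"
  using assms by (auto simp: numeral_3_eq_3 less_Suc_eq)

text \<open>Names the witnesses hidden in \<open>inflates\<close>. The edge \<open>fi\<close> is
  opposite to \<open>wi\<close> in the triangle, and \<open>e1\<close> is singled out in
  \<open>extend_matching\<close>.\<close>

locale triangle_inflation =
  fixes G H :: "('v, 'e) mgraph" and w e1 e2 e3 w1 w2 w3 f1 f2 f3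
  assumes G: "loopless_cubic G" and w: "w \<in> verts G"
    and dist: "distinct [e1, e2, e3]" "distinct [w1, w2, w3]" "distinct [f1, f2, f3]"
    and inc_w: "inc_edges G w = {e1, e2, e3}"
    and fresh: "{w1, w2, w3} \<inter> verts G = {}" "{f1, f2, f3} \<inter> edges G = {}"
    and verts_H: "verts H = (verts G - {w}) \<union> {w1, w2, w3}"
    and edges_H: "edges H = edges G \<union> {f1, f2, f3}"
    and ends_f: "ends H f1 = {#w2, w3#}" "ends H f2 = {#w1, w3#}" "ends H f3 = {#w1, w2#}"
    and ends_e: "ends H e1 = add_mset w1 (ends G e1 - {#w#})"
      "ends H e2 = add_mset w2 (ends G e2 - {#w#})"
      "ends H e3 = add_mset w3 (ends G e3 - {#w#})"
    and ends_old: "\<And>e. e \<in> edges G - {e1, e2, e3} \<Longrightarrow> ends H e = ends G e"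
begin

lemma edges_at_w: "e1 \<in> edges G" "e2 \<in> edges G" "e3 \<in> edges G"
  using inc_w by (auto simp: inc_edges_def)

lemma other_end_w:
  assumes "e \<in> {e1, e2, e3}"
  obtains y where "y \<noteq> w" "y \<in> verts G" "ends G e = {#w, y#}"
proof -
  have "e \<in> edges G" "w \<in># ends G e" using assms inc_w by (auto simp: inc_edges_def)
  then show thesis using loopless_cubic_other_end[OF G] that by blast
qed

text \<open>As \<open>G\<close> has no loops, removing one copy of \<open>w\<close> from the ends of
  an edge removes \<open>w\<close> altogether, so incidence in \<open>H\<close> can be described
  without multiplicities.\<close>

lemma in_ends_H:
  assumes "e \<in> edges G"
  shows "z \<in># ends H e \<longleftrightarrow> z \<in># ends G e \<and> z \<noteq> w \<or>
    e = e1 \<and> z = w1 \<or> e = e2 \<and> z = w2 \<or> e = e3 \<and> z = w3"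
proof (cases "e \<in> {e1, e2, e3}")
  case True
  then obtain y where "y \<noteq> w" "y \<in> verts G" "ends G e = {#w, y#}" using other_end_w by blast
  with True show ?thesis using ends_e dist by auto
next
  case False
  then have "w \<notin># ends G e" using assms inc_w by (auto simp: inc_edges_def)
  with False assms show ?thesis using ends_old by auto
qed

lemma ends_G_verts: "e \<in> edges G \<Longrightarrow> set_mset (ends G e) \<subseteq> verts G"
  using G by (auto simp: loopless_cubic_def finite_mgraph_def)

lemma inc_edges_old:
  assumes "x \<in> verts G" "x \<noteq> w"
  shows "inc_edges H x = inc_edges G x"
  using assms fresh in_ends_H by (auto simp: inc_edges_def edges_H ends_f)

lemma inc_edges_new:
  "inc_edges H w1 = {e1, f2, f3}" "inc_edges H w2 = {e2, f1, f3}" "inc_edges H w3 = {e3, f1, f2}"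
  using fresh in_ends_H ends_G_verts edges_at_w dist
  by (fastforce simp: inc_edges_def edges_H ends_f)+

lemma f_notin: "f1 \<notin> edges G" "f2 \<notin> edges G" "f3 \<notin> edges G"
  using fresh by auto

lemma loopless_cubic_H: "loopless_cubic H"
  unfolding loopless_cubic_def
proof (intro conjI ballI)
  have old: "\<exists>y z. ends H e = {#y, z#} \<and> y \<noteq> z \<and> y \<in> verts H \<and> z \<in> verts H" if e: "e \<in> edges G" for e
  proof (cases "e \<in> {e1, e2, e3}")
    case True
    then obtain y where "y \<noteq> w" "y \<in> verts G" "ends G e = {#w, y#}" using other_end_w by blast
    moreover from True obtain z where "z \<in> {w1, w2, w3}" "ends H e = add_mset z (ends G e - {#w#})"
      using ends_e by blast
    ultimately show ?thesis using fresh
      by (intro exI[of _ z] exI[of _ y]) (auto simp: verts_H)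
  next
    case False
    have "size (ends G e) = 2" using G that by (auto simp: loopless_cubic_def finite_mgraph_def)
    then obtain x where "x \<in># ends G e" by fastforce
    then obtain y where y: "y \<noteq> x" "x \<in> verts G" "y \<in> verts G" "ends G e = {#x, y#}"
      using loopless_cubic_other_end[OF G e] by blast
    moreover have "w \<notin># ends G e" using False that inc_w by (auto simp: inc_edges_def)
    ultimately show ?thesis using ends_old[of e] False that
      by (intro exI[of _ x] exI[of _ y]) (auto simp: verts_H)
  qed
  have all: "\<exists>y z. ends H e = {#y, z#} \<and> y \<noteq> z \<and> y \<in> verts H \<and> z \<in> verts H" if "e \<in> edges H" for e
    using that old[of e] ends_f dist by (auto simp: edges_H verts_H)
  show "finite_mgraph H"
    unfolding finite_mgraph_def
  proof (intro conjI ballI)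
    show "finite (verts H)" "finite (edges H)"
      using loopless_cubicD[OF G] by (auto simp: verts_H edges_H)
  qed (use all in fastforce)+
  show "\<not> is_loop H e" if "e \<in> edges H" for e
    using all[OF that] by (auto simp: is_loop_def add_eq_conv_ex)
  show "card (inc_edges H x) = 3" if "x \<in> verts H" for x
    using that inc_edges_old[of x] inc_edges_new loopless_cubicD(4)[OF G] dist f_notin edges_at_w
    by (auto simp: verts_H card_insert_if)
qed

text \<open>At \<open>w1\<close> the edge \<open>e1\<close> avoids the colours of \<open>f2\<close>
  and \<open>f3\<close>, as \<open>f1\<close> does, so \<open>e1\<close> and \<open>f1\<close>
  agree; likewise for the other two. The triangle has three colours, hence so do the edges at
  \<open>w\<close>, and restricting the colouring to \<open>edges G\<close> suffices.\<close>

lemma three_edge_colourable_G: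
  assumes "three_edge_colourable H"
  shows "three_edge_colourable G"
proof -
  obtain c where c: "\<forall>e\<in>edges H. c e < (3::nat)" "\<forall>x\<in>verts H. inj_on c (inc_edges H x)"
    using assms three_edge_colourable_iff[OF loopless_cubic_H] by blast
  have "inj_on c (inc_edges G x)" if x: "x \<in> verts G" for x
  proof (cases "x = w")
    case False
    then show ?thesis using c(2) x inc_edges_old by (auto simp: verts_H)
  next
    case True
    have "inj_on c {e1, f2, f3}" "inj_on c {e2, f1, f3}" "inj_on c {e3, f1, f2}"
      using c(2) inc_edges_new by (auto simp: verts_H)
    moreover have "e1 \<noteq> f2" "e1 \<noteq> f3" "e2 \<noteq> f1" "e2 \<noteq> f3" "e3 \<noteq> f1" "e3 \<noteq> f2"
      using f_notin edges_at_w by auto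
    ultimately have "c e1 \<noteq> c f2" "c e1 \<noteq> c f3" "c f2 \<noteq> c f3" "c e2 \<noteq> c f1" "c e2 \<noteq> c f3"
      "c f1 \<noteq> c f3" "c e3 \<noteq> c f1" "c e3 \<noteq> c f2" "c f1 \<noteq> c f2"
      using dist by (auto simp: inj_on_def)
    moreover have "c e1 < 3" "c e2 < 3" "c e3 < 3" "c f1 < 3" "c f2 < 3" "c f3 < 3"
      using c(1) edges_at_w by (auto simp: edges_H)
    ultimately have "c e1 = c f1" "c e2 = c f2" "c e3 = c f3" using third_colour by blast+
    then show ?thesis using True inc_w \<open>c f1 \<noteq> c f3\<close> \<open>c f2 \<noteq> c f3\<close> \<open>c f1 \<noteq> c f2\<close>
      by (auto simp: inj_on_def)
  qed
  moreover have "\<forall>e\<in>edges G. c e < 3" using c(1) by (simp add: edges_H)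
  ultimately show ?thesis using three_edge_colourable_iff[OF G] by blast
qed

text \<open>\<open>e1\<close> covers \<open>w1\<close>; the vertices \<open>w2\<close> and
  \<open>w3\<close> are covered by \<open>e2\<close> and \<open>e3\<close> if these lie in
  \<open>N\<close>, and otherwise jointly by \<open>f1\<close>. So \<open>N\<close> may contain all
  three edges at \<open>w\<close>. The set \<open>S\<close> holds vertices at which the matching
  condition is postponed.\<close>

lemma extend_matching:
  assumes N: "N \<subseteq> edges G" "e1 \<in> N" "e2 \<in> N \<longleftrightarrow> e3 \<in> N"
    and match: "\<And>x. x \<in> verts G - {w} - S \<Longrightarrow> \<exists>a. N \<inter> inc_edges G x = {a}"
    and x: "x \<in> verts H - S"
  shows "\<exists>a. (if e2 \<in> N then N else insert f1 N) \<inter> inc_edges H x = {a}"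
proof (cases "x \<in> verts G - {w}")
  case True
  then obtain a where a: "N \<inter> inc_edges G x = {a}" using match x by blast
  moreover have "f1 \<notin> inc_edges G x" using f_notin by (simp add: inc_edges_def)
  ultimately show ?thesis using True inc_edges_old[of x] by auto
next
  case False
  then have "x = w1 \<or> x = w2 \<or> x = w3" using x by (auto simp: verts_H)
  moreover have "f1 \<notin> N" "f2 \<notin> N" "f3 \<notin> N" using N f_notin by auto
  moreover have "(if e2 \<in> N then N else insert f1 N) \<inter> {e1, f2, f3} = {e1}"
    "(if e2 \<in> N then N else insert f1 N) \<inter> {e2, f1, f3} = {if e2 \<in> N then e2 else f1}"
    "(if e2 \<in> N then N else insert f1 N) \<inter> {e3, f1, f2} = {if e2 \<in> N then e3 else f1}"
    using N calculation(2-) dist by auto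
  ultimately show ?thesis using inc_edges_new by metis
qed

end

text \<open>The triangle is symmetric: exchanging index 1 with 2 or with 3 throughout preserves all
  conditions, so any chosen edge at \<open>w\<close> can take the role of \<open>e1\<close>.\<close>

lemma inflates_triangle:
  assumes G: "loopless_cubic G" and H: "inflates G w H" and e: "e \<in> inc_edges G w"
  shows "\<exists>e2 e3 w1 w2 w3 f1 f2 f3. triangle_inflation G H w e e2 e3 w1 w2 w3 f1 f2 f3"
proof -
  have w: "w \<in> verts G" using H by (simp add: inflates_def)
  obtain e1 e2 e3 w1 w2 w3 f1 f2 f3 where
    "distinct [e1, e2, e3] \<and> inc_edges G w = {e1, e2, e3} \<and>
     distinct [w1, w2, w3] \<and> {w1, w2, w3} \<inter> verts G = {} \<and>
     distinct [f1, f2, f3] \<and> {f1, f2, f3} \<inter> edges G = {} \<and>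
     verts H = (verts G - {w}) \<union> {w1, w2, w3} \<and>
     edges H = edges G \<union> {f1, f2, f3} \<and>
     ends H f1 = {#w2, w3#} \<and> ends H f2 = {#w1, w3#} \<and> ends H f3 = {#w1, w2#} \<and>
     ends H e1 = add_mset w1 (ends G e1 - {#w#}) \<and>
     ends H e2 = add_mset w2 (ends G e2 - {#w#}) \<and>
     ends H e3 = add_mset w3 (ends G e3 - {#w#}) \<and>
     (\<forall>e\<in>edges G - {e1, e2, e3}. ends H e = ends G e)"
    using H[unfolded inflates_def, THEN conjunct2] by (elim exE) (erule that)
  then have t: "triangle_inflation G H w e1 e2 e3 w1 w2 w3 f1 f2 f3"
    using G w by (elim conjE) (rule triangle_inflation.intro; (assumption | erule (1) bspec))
  interpret t: triangle_inflation G H w e1 e2 e3 w1 w2 w3 f1 f2 f3 by (rule t)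
  have "triangle_inflation G H w e2 e1 e3 w2 w1 w3 f2 f1 f3"
    using t.dist t.fresh
    by unfold_locales (auto simp: G w t.inc_w t.verts_H t.edges_H t.ends_f t.ends_e t.ends_old)
  moreover have "triangle_inflation G H w e3 e2 e1 w3 w2 w1 f3 f2 f1"
    using t.dist t.fresh
    by unfold_locales (auto simp: G w t.inc_w t.verts_H t.edges_H t.ends_f t.ends_e t.ends_old)
  moreover have "e = e1 \<or> e = e2 \<or> e = e3"
    using e triangle_inflation.inc_w[OF t] by auto
  ultimately show ?thesis using t by blast
qed

lemma inflates_loopless_cubic:
  assumes "loopless_cubic G" "inflates G w H"
  shows "loopless_cubic H" "three_edge_colourable H \<Longrightarrow> three_edge_colourable G"
proof -
  obtain e where "e \<in> inc_edges G w" using assms(2) by (auto simp: inflates_def)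
  then obtain e2 e3 w1 w2 w3 f1 f2 f3 where t: "triangle_inflation G H w e e2 e3 w1 w2 w3 f1 f2 f3"
    using inflates_triangle[OF assms] by blast
  show "loopless_cubic H" "three_edge_colourable H \<Longrightarrow> three_edge_colourable G"
    using triangle_inflation.loopless_cubic_H[OF t]
      triangle_inflation.three_edge_colourable_G[OF t] by auto
qed

section \<open>Extending a colouring, and parity\<close>

text \<open>A deleted edge has at most one end outside \<open>S\<close>, so the deleted edges at
  each \<open>x\<close> outside \<open>S\<close> can receive the colours still free at
  \<open>x\<close>, independently of other vertices.\<close>

lemma extend_colouring:
  assumes G: "loopless_cubic G" and col: "three_edge_colourable (delete_verts G S)"
  obtains c :: "'e \<Rightarrow> nat" where "\<And>e. e \<in> edges G \<Longrightarrow> c e < 3"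
    "\<And>x. x \<in> verts G - S \<Longrightarrow> inj_on c (inc_edges G x)"
proof -
  let ?D = "edges (delete_verts G S)"
  have D: "?D = {e \<in> edges G. set_mset (ends G e) \<inter> S = {}}" by (simp add: delete_verts_def)
  obtain c where c: "three_edge_colouring (delete_verts G S) c"
    using col by (auto simp: three_edge_colourable_def)
  have c3: "c e < 3" if "e \<in> ?D" for e using c that by (auto simp: three_edge_colouring_def)
  have cinj: "inj_on c (inc_edges G x \<inter> ?D)" for x
    using c unfolding three_edge_colouring_def inj_on_def
    by (auto simp: inc_edges_def delete_verts_def)
  have "\<exists>g. bij_betw g (inc_edges G x - ?D) ({..<3} - c ` (inc_edges G x \<inter> ?D))"
    if x: "x \<in> verts G" for x
  proof (rule finite_same_card_bij)
    have fin: "finite (inc_edges G x)" "card (inc_edges G x) = 3"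
      using loopless_cubicD[OF G] x by auto
    have "card (inc_edges G x - ?D) = 3 - card (inc_edges G x \<inter> ?D)"
      using fin by (simp add: card_Diff_subset_Int)
    moreover have "c ` (inc_edges G x \<inter> ?D) \<subseteq> {..<3}" using c3 by auto
    then have "card ({..<3} - c ` (inc_edges G x \<inter> ?D)) = 3 - card (inc_edges G x \<inter> ?D)"
      using fin cinj by (simp add: card_Diff_subset card_image)
    ultimately show "card (inc_edges G x - ?D) = card ({..<3} - c ` (inc_edges G x \<inter> ?D))" by simp
  qed (use loopless_cubicD[OF G] in auto)
  then obtain g where
    g: "\<And>x. x \<in> verts G \<Longrightarrow> bij_betw (g x) (inc_edges G x - ?D) ({..<3} - c ` (inc_edges G x \<inter> ?D))"
    by metis
  \<comment> \<open>For a deleted edge, \<open>P e x\<close> says that \<open>x\<close> is its end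
    outside \<open>S\<close>, which is unique if it exists. Edges inside \<open>S\<close> get the
    arbitrary colour 0.\<close>
  define P where "P e x \<longleftrightarrow> x \<in> verts G - S \<and> x \<in># ends G e" for e x
  define c' where "c' e = (if e \<in> ?D then c e else if \<exists>x. P e x then g (SOME x. P e x) e else 0)" for e
  have c'_new: "c' e = g x e" if "x \<in> verts G - S" "e \<in> inc_edges G x - ?D" for e x
  proof -
    have e: "e \<in> edges G" "x \<in># ends G e" using that by (auto simp: inc_edges_def)
    then obtain y where y: "ends G e = {#x, y#}" using loopless_cubic_other_end[OF G] by blast
    then have "y \<in> S" using that e D by auto
    then have "P e z \<longleftrightarrow> z = x" for z using that y by (auto simp: P_def)
    then have "(SOME z. P e z) = x" "\<exists>z. P e z" by auto
    then show ?thesis using that by (simp add: c'_def)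
  qed
  show thesis
  proof
    show "c' e < 3" if e: "e \<in> edges G" for e
    proof -
      consider "e \<in> ?D" | x where "e \<notin> ?D" "P e x" | "e \<notin> ?D" "\<not> (\<exists>x. P e x)" by blast
      then show ?thesis
      proof cases
        case (2 x)
        then have "x \<in> verts G - S" "e \<in> inc_edges G x - ?D"
          using e by (auto simp: P_def inc_edges_def)
        then show ?thesis using c'_new bij_betwE[OF g] by fastforce
      qed (auto simp: c'_def c3)
    qed
    show "inj_on c' (inc_edges G x)" if x: "x \<in> verts G - S" for x
    proof -
      have "bij_betw c' (inc_edges G x - ?D) ({..<3} - c ` (inc_edges G x \<inter> ?D))"
        by (rule iffD2[OF bij_betw_cong[where g = "g x"] g]) (use c'_new[OF x] x in auto)
      then have new: "inj_on c' (inc_edges G x - ?D)"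
        "c' ` (inc_edges G x - ?D) = {..<3} - c ` (inc_edges G x \<inter> ?D)"
        by (simp_all add: bij_betw_def)
      have old: "inj_on c' (inc_edges G x \<inter> ?D)"
        "c' ` (inc_edges G x \<inter> ?D) = c ` (inc_edges G x \<inter> ?D)"
        using cinj[of x] by (auto simp: c'_def inj_on_def image_def)
      have "inj_on c' ((inc_edges G x \<inter> ?D) \<union> (inc_edges G x - ?D))"
      proof (subst inj_on_Un, intro conjI old(1) new(1))
        have "c' ` (inc_edges G x \<inter> ?D) \<inter> c' ` (inc_edges G x - ?D) = {}"
          unfolding new(2) old(2) by blast
        then show "c' ` (inc_edges G x \<inter> ?D - (inc_edges G x - ?D)) \<inter>
            c' ` (inc_edges G x - ?D - inc_edges G x \<inter> ?D) = {}"
          by blast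
      qed
      moreover have "(inc_edges G x \<inter> ?D) \<union> (inc_edges G x - ?D) = inc_edges G x" by blast
      ultimately show ?thesis by simp
    qed
  qed
qed

lemma inj_on_colour_class:
  assumes "inj_on c A" "card A = 3" "\<And>e. e \<in> A \<Longrightarrow> c e < (3::nat)" "k < 3"
  shows "\<exists>a. {e \<in> A. c e = k} = {a}"
proof -
  have "c ` A = {..<3}"
    using assms by (intro card_seteq) (auto simp: card_image)
  then obtain a where "a \<in> A" "c a = k" using assms(4) by (metis imageE lessThan_iff)
  then have "{e \<in> A. c e = k} = {a}" using assms(1) by (auto simp: inj_on_def)
  then show ?thesis ..
qed

text \<open>Let \<open>M\<close> be the edges of colour \<open>k\<close> other than
  \<open>e0\<close>. Every vertex except \<open>u\<close> and \<open>v\<close> meets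
  \<open>M\<close> exactly once, and |V| is even because 3|V| = 2|E|; so the handshake count leaves
  an even sum at \<open>u\<close> and \<open>v\<close>.\<close>

lemma colour_parity:
  assumes G: "loopless_cubic G" and uv: "u \<in> verts G" "v \<in> verts G" "u \<noteq> v"
    and e0: "e0 \<in> edges G" "ends G e0 = {#u, v#}"
    and c3: "\<And>e. e \<in> edges G \<Longrightarrow> c e < (3::nat)"
    and inj: "\<And>x. x \<in> verts G - {u, v} \<Longrightarrow> inj_on c (inc_edges G x)"
    and k: "k < 3"
  shows "even (card {e \<in> inc_edges G u - {e0}. c e = k} + card {e \<in> inc_edges G v - {e0}. c e = k})"
proof -
  let ?M = "{e \<in> edges G - {e0}. c e = k}"
  let ?d = "\<lambda>x. card {e \<in> ?M. x \<in># ends G e}"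
  have d: "?d x = card {e \<in> inc_edges G x - {e0}. c e = k}" for x
    by (rule arg_cong[where f = card]) (auto simp: inc_edges_def)
  have one: "?d x = 1" if x: "x \<in> verts G - {u, v}" for x
  proof -
    have inc: "inc_edges G x - {e0} = inc_edges G x" using x e0 by (auto simp: inc_edges_def)
    have "\<exists>a. {e \<in> inc_edges G x. c e = k} = {a}"
      using inj[OF x] x loopless_cubicD[OF G] c3 k
      by (intro inj_on_colour_class) (auto simp: inc_edges_def)
    then obtain a where a: "{e \<in> inc_edges G x. c e = k} = {a}" ..
    show ?thesis unfolding d inc a by simp
  qed
  have fin: "finite (verts G)" using loopless_cubicD[OF G] by auto
  have "2 * card ?M = (\<Sum>x\<in>verts G. ?d x)"
    by (rule handshake[OF G, symmetric]) blast
  also have "\<dots> = (\<Sum>x\<in>verts G - {u, v}. ?d x) + (\<Sum>x\<in>{u, v}. ?d x)"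
    using uv fin by (intro sum.subset_diff) auto
  also have "(\<Sum>x\<in>verts G - {u, v}. ?d x) = card (verts G - {u, v})"
    using one by simp
  also have "(\<Sum>x\<in>{u, v}. ?d x) = ?d u + ?d v" using uv by simp
  finally have count: "2 * card ?M = card (verts G - {u, v}) + (?d u + ?d v)" .
  have "card (verts G) = card (verts G - {u, v}) + card {u, v}"
    using uv fin card_Diff_subset[of "{u, v}" "verts G"] card_mono[of "verts G" "{u, v}"] by auto
  then have "card (verts G) = card (verts G - {u, v}) + 2" using uv by simp
  then have "even (?d u + ?d v)"
    using count card_edges_loopless_cubic[OF G] by presburger
  then show ?thesis by (simp only: d)
qed

lemma card_colour_pair:
  assumes "a \<noteq> b"
  shows "card {e \<in> {a, b}. c e = k} = of_bool (c a = k) + of_bool (c b = k)"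
proof -
  have "{e \<in> {a, b}. c e = k} = (if c a = k then {a} else {}) \<union> (if c b = k then {b} else {})"
    by auto
  then show ?thesis using assms by simp
qed

text \<open>
  If the two edges at \<open>u\<close> other than \<open>e0\<close> had distinct colours, the same two colours would
  occur at \<open>v\<close> by parity, and giving the third colour to \<open>e0\<close> would colour \<open>G\<close>.
\<close>

lemma equal_colours:
  assumes G: "loopless_cubic G" and nc: "\<not> three_edge_colourable G"
    and uv: "u \<in> verts G" "v \<in> verts G" "u \<noteq> v"
    and e0: "e0 \<in> edges G" "ends G e0 = {#u, v#}"
    and c3: "\<And>e. e \<in> edges G \<Longrightarrow> c e < (3::nat)"
    and inj: "\<And>x. x \<in> verts G - {u, v} \<Longrightarrow> inj_on c (inc_edges G x)"
    and a: "inc_edges G u = {e0, a1, a2}" "distinct [e0, a1, a2]"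
    and b: "inc_edges G v = {e0, b1, b2}" "distinct [e0, b1, b2]"
  shows "c a1 = c a2" "c b1 = c b2"
proof -
  have diff: "inc_edges G u - {e0} = {a1, a2}" "inc_edges G v - {e0} = {b1, b2}"
    using a b by auto
  have ne12: "a1 \<noteq> a2" "b1 \<noteq> b2" using a b by auto
  have par: "even (of_bool (c a1 = k) + of_bool (c a2 = k) +
      (of_bool (c b1 = k) + of_bool (c b2 = k)) :: nat)"
    if "k < 3" for k
  proof -
    have "even (card {e \<in> inc_edges G u - {e0}. c e = k} + card {e \<in> inc_edges G v - {e0}. c e = k})"
      by (rule colour_parity[OF G uv e0 _ _ that]) (use c3 inj in auto)
    then show ?thesis unfolding diff card_colour_pair[OF ne12(1)] card_colour_pair[OF ne12(2)] .
  qed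
  have "a1 \<in> edges G" "a2 \<in> edges G" "b1 \<in> edges G" "b2 \<in> edges G"
    using a b by (auto simp: inc_edges_def)
  then have lt: "c a1 < 3" "c a2 < 3" "c b1 < 3" "c b2 < 3" using c3 by auto
  show eqa: "c a1 = c a2"
  proof (rule ccontr)
    assume ne: "c a1 \<noteq> c a2"
    \<comment> \<open>Each of the two colours occurs once at \<open>u\<close> apart from
      \<open>e0\<close>, so an odd number of times among \<open>b1\<close> and \<open>b2\<close>,
      that is, once.\<close>
    then have bs: "c b1 = c a1 \<and> c b2 = c a2 \<or> c b1 = c a2 \<and> c b2 = c a1"
      using par[of "c a1"] par[of "c a2"] lt by (auto split: if_splits simp: of_bool_def)
    \<comment> \<open>The colours 0, 1, 2 add up to 3, so this is the one missing at
      \<open>u\<close> and \<open>v\<close>.\<close>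
    define r where "r = 3 - c a1 - c a2"
    have r: "r < 3" "r \<noteq> c a1" "r \<noteq> c a2"
      using ne lt unfolding r_def by presburger+
    let ?c = "c(e0 := r)"
    have "inj_on ?c (inc_edges G x)" if x: "x \<in> verts G" for x
    proof -
      consider "x = u" | "x = v" | "x \<in> verts G - {u, v}" using x by blast
      then show ?thesis
      proof cases
        case 1 then show ?thesis using a ne r by auto
      next
        case 2 then show ?thesis using b bs ne r by auto
      next
        case 3
        then have "e0 \<notin> inc_edges G x" using e0 by (auto simp: inc_edges_def)
        then show ?thesis using inj[OF 3] by (auto simp: inj_on_def)
      qed
    qed
    moreover have "\<forall>e\<in>edges G. ?c e < 3" using c3 r by simp
    ultimately show False using nc three_edge_colourable_iff[OF G] by blast
  qed
  \<comment> \<open>With equal colours at \<open>u\<close>, every colour occurs an even number of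
    times among \<open>b1\<close> and \<open>b2\<close>.\<close>
  show "c b1 = c b2"
    using par[of "c b1"] lt eqa by (auto split: if_splits simp: of_bool_def)
qed

section \<open>The two bounds on the defect\<close>

lemma defect_le:
  assumes "three_array G M1 M2 M3" "card (uncovered G M1 M2 M3) \<le> n"
  shows "defect G \<le> n"
proof -
  have "defect G \<le> card (uncovered G M1 M2 M3)"
    unfolding defect_def using assms(1) by (intro Least_le) blast
  with assms(2) show ?thesis by simp
qed

theorem theorem4p2:
  fixes G G' Gbar :: "('v, 'e) mgraph" and u v :: 'v
  assumes "snark G"
    and "adjacent G u v"
    and "non_removable G u v"
    and "inflates G u G'"
    and "inflates G' v Gbar"
  shows "3 \<le> defect Gbar \<and> defect Gbar \<le> 4"
proof -
  have G: "loopless_cubic G" and nc: "\<not> three_edge_colourable G"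
    using assms(1) snark_loopless_cubic by (auto simp: snark_def)
  have G': "loopless_cubic G'" using inflates_loopless_cubic[OF G assms(4)] by blast
  have Gbar: "loopless_cubic Gbar" and nc_bar: "\<not> three_edge_colourable Gbar"
    using inflates_loopless_cubic[OF G assms(4)] inflates_loopless_cubic[OF G' assms(5)] nc
    by blast+
  have uv: "u \<in> verts G" "v \<in> verts G" "u \<noteq> v" and col: "three_edge_colourable (delete_verts G {u, v})"
    using assms(3) by (auto simp: non_removable_def)
  obtain e0 where e0: "e0 \<in> edges G" "ends G e0 = {#u, v#}"
    using assms(2) by (auto simp: adjacent_def)
  then have e0_inc: "e0 \<in> inc_edges G u" "e0 \<in> inc_edges G v" by (auto simp: inc_edges_def)
  obtain a1 a2 u0 u1 u2 f0 f1 f2 where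
    tu: "triangle_inflation G G' u e0 a1 a2 u0 u1 u2 f0 f1 f2"
    using inflates_triangle[OF G assms(4) e0_inc(1)] by blast
  interpret tu: triangle_inflation G G' u e0 a1 a2 u0 u1 u2 f0 f1 f2 by (rule tu)
  \<comment> \<open>Inflating \<open>u\<close> leaves the edges at \<open>v\<close> unchanged, so
    \<open>e0\<close> can be singled out again when \<open>v\<close> is inflated.\<close>
  have inc_v: "inc_edges G' v = inc_edges G v" using tu.inc_edges_old uv by auto
  obtain b1 b2 v0 v1 v2 h0 h1 h2 where
    tv: "triangle_inflation G' Gbar v e0 b1 b2 v0 v1 v2 h0 h1 h2"
    using inflates_triangle[OF G' assms(5)] e0_inc(2) inc_v by metis
  interpret tv: triangle_inflation G' Gbar v e0 b1 b2 v0 v1 v2 h0 h1 h2 by (rule tv)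
  obtain c :: "'e \<Rightarrow> nat" where c3: "\<And>e. e \<in> edges G \<Longrightarrow> c e < 3"
    and inj: "\<And>x. x \<in> verts G - {u, v} \<Longrightarrow> inj_on c (inc_edges G x)"
    using extend_colouring[OF G col] by blast
  have inc: "inc_edges G u = {e0, a1, a2}" "inc_edges G v = {e0, b1, b2}"
    using tu.inc_w tv.inc_w inc_v by auto
  have eq: "c a1 = c a2" "c b1 = c b2"
    using equal_colours[OF G nc uv e0 c3 inj inc(1) tu.dist(1) inc(2) tv.dist(1)] by auto
  have bE: "b1 \<in> edges G" "b2 \<in> edges G" using inc(2) by (auto simp: inc_edges_def)
  have aE: "a1 \<in> edges G" "a2 \<in> edges G" using inc(1) by (auto simp: inc_edges_def)
  \<comment> \<open>\<open>e0\<close> joins every class, whatever its own colour. As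
    \<open>a1\<close> and \<open>a2\<close> have equal colours, \<open>N k\<close> contains both or
    neither, which is the situation of \<open>extend_matching\<close>; likewise at
    \<open>v\<close>.\<close>
  define N where "N k = insert e0 {e \<in> edges G. c e = k}" for k
  define N' where "N' k = (if a1 \<in> N k then N k else insert f0 (N k))" for k
  define M where "M k = (if b1 \<in> N' k then N' k else insert h0 (N' k))" for k
  have N_sub: "N k \<subseteq> edges G" for k using e0 by (auto simp: N_def)
  have aN: "a1 \<in> N k \<longleftrightarrow> c a1 = k" "a2 \<in> N k \<longleftrightarrow> c a1 = k"
    and bN: "b1 \<in> N' k \<longleftrightarrow> c b1 = k" "b2 \<in> N' k \<longleftrightarrow> c b1 = k" for k
    using aE bE eq tu.dist(1) tv.dist(1) tu.f_notin by (auto simp: N_def N'_def)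
  have stepN: "\<exists>a. N k \<inter> inc_edges G x = {a}" if k: "k < 3" and x: "x \<in> verts G - {u} - {v}" for k x
  proof -
    have "\<exists>a. {e \<in> inc_edges G x. c e = k} = {a}"
      using inj[of x] x loopless_cubicD[OF G] c3 k
      by (intro inj_on_colour_class) (auto simp: inc_edges_def)
    moreover have "e0 \<notin> inc_edges G x" using e0 x by (auto simp: inc_edges_def)
    then have "N k \<inter> inc_edges G x = {e \<in> inc_edges G x. c e = k}"
      by (auto simp: N_def inc_edges_def)
    ultimately show ?thesis by simp
  qed
  \<comment> \<open>\<open>N' k\<close> may contain all three edges at \<open>v\<close>, which is
    not yet inflated; hence \<open>v\<close> is exempted.\<close>
  have stepN': "\<exists>a. N' k \<inter> inc_edges G' x = {a}" if k: "k < 3" and x: "x \<in> verts G' - {v}" for k x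
    unfolding N'_def
    by (rule tu.extend_matching[where S = "{v}"])
      (use N_sub aN stepN[OF k] x in \<open>auto simp: N_def\<close>)
  have stepM: "\<exists>a. M k \<inter> inc_edges Gbar x = {a}" if k: "k < 3" and x: "x \<in> verts Gbar" for k x
    unfolding M_def
  proof (rule tv.extend_matching[where S = "{}"])
    show "N' k \<subseteq> edges G'" using N_sub[of k] by (auto simp: N'_def tu.edges_H)
    show "e0 \<in> N' k" by (simp add: N'_def N_def)
    show "b1 \<in> N' k \<longleftrightarrow> b2 \<in> N' k" using bN by simp
  qed (use stepN'[OF k] x in auto)
  have M_sub: "M k \<subseteq> edges Gbar" for k
    using N_sub[of k] by (auto simp: M_def N'_def tu.edges_H tv.edges_H)
  have pm: "perfect_matching Gbar (M k)" if k: "k < 3" for k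
    unfolding perfect_matching_def
  proof (intro conjI ballI)
    show "M k \<subseteq> edges Gbar" by (rule M_sub)
    show "\<not> is_loop Gbar e" if "e \<in> M k" for e
      using that M_sub Gbar by (auto simp: loopless_cubic_def)
    fix x assume "x \<in> verts Gbar"
    then obtain a where "M k \<inter> inc_edges Gbar x = {a}" using stepM[OF k] by blast
    moreover have "M k \<inter> inc_edges Gbar x = {e. e \<in> M k \<and> x \<in># ends Gbar e}"
      using M_sub[of k] by (auto simp: inc_edges_def)
    ultimately show "\<exists>!e. e \<in> M k \<and> x \<in># ends Gbar e"
      by (intro ex1I[of _ a]) blast+
  qed
  then have arr: "three_array Gbar (M 0) (M 1) (M 2)" by (simp add: three_array_def)
  have "e \<in> M 0 \<union> M 1 \<union> M 2" if "e \<in> edges G" for e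
  proof -
    have "e \<in> M (c e)" using that by (simp add: M_def N'_def N_def)
    moreover have "c e = 0 \<or> c e = 1 \<or> c e = 2" using c3[OF that] by linarith
    ultimately show ?thesis by auto
  qed
  \<comment> \<open>\<open>f0\<close> is added for every \<open>k\<close> other than the colour of
    \<open>a1\<close>, hence for 0 or for 1; similarly \<open>h0\<close>.\<close>
  moreover have "f0 \<in> M 0 \<union> M 1" "h0 \<in> M 0 \<union> M 1"
    using aN bN by (auto simp: M_def N'_def)
  ultimately have "uncovered Gbar (M 0) (M 1) (M 2) \<subseteq> {f1, f2, h1, h2}"
    unfolding uncovered_def tv.edges_H tu.edges_H by blast
  then have "card (uncovered Gbar (M 0) (M 1) (M 2)) \<le> card {f1, f2, h1, h2}"
    by (intro card_mono) auto
  also have "\<dots> \<le> 4" by (simp add: card_insert_if)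
  finally have le: "defect Gbar \<le> 4" by (rule defect_le[OF arr])
  \<comment> \<open>The minimum is attained because the array built for the upper bound shows that
    3-arrays exist.\<close>
  have "\<exists>M1 M2 M3. three_array Gbar M1 M2 M3 \<and> card (uncovered Gbar M1 M2 M3) = defect Gbar"
    unfolding defect_def by (rule LeastI_ex) (use arr in blast)
  then have "3 \<le> defect Gbar" using uncovered_ge_3[OF Gbar nc_bar] by metis
  with le show ?thesis by blast
qed

end
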